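(* If $G$ is a block graph, then the $2$-independence complex $\mathrm{Ind}_2(G)$ is shellable.
   Context: All graphs are finite and simple. A block of a graph is a maximal connected subgraph that remains connected after removal of any single vertex; $G$ is a block graph if every block of $G$ is a complete graph. For a graph $G$ and integer $r \geq 1$, a subset $A \subseteq V(G)$ is $r$-independent if every connected component of the induced subgraph $G[A]$ has at most $r$ vertices; $\mathrm{Ind}_r(G)$ is the simplicial complex on $V(G)$ whose faces are the $r$-independent subsets. A (not necessarily pure) simplicial complex is shellable if its facets can be ordered $F_1, \dots, F_t$ so that for each $k>1$, $\langle F_k\rangle \cap \langle F_1,\dots,F_{k-1}\rangle$ is pure of dimension $\dim F_k - 1$ ($\langle \mathcal F\rangle$ = complex generated by $\mathcal F$). *)

theory Defs
  imports "Graph_Theory.Graph_Theory"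
begin

section \<open>Simplicial complexes and shellability\<close>

text \<open>A complex is represented by its set of faces, the empty face included.\<close>

definition simplicial_complex :: "'a set \<Rightarrow> 'a set set \<Rightarrow> bool" where
  "simplicial_complex V K \<longleftrightarrow>
     finite V \<and> {} \<in> K \<and> (\<forall>F\<in>K. F \<subseteq> V) \<and> (\<forall>F\<in>K. \<forall>F'. F' \<subseteq> F \<longrightarrow> F' \<in> K)"

definition face_dim :: "'a set \<Rightarrow> int" where
  "face_dim F = int (card F) - 1"

definition facets :: "'a set set \<Rightarrow> 'a set set" where
  "facets K = {F \<in> K. \<forall>F'\<in>K. F \<subseteq> F' \<longrightarrow> F' = F}"

definition generated_complex :: "'a set set \<Rightarrow> 'a set set" where
  "generated_complex \<F> = {A. \<exists>F\<in>\<F>. A \<subseteq> F}"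

text \<open>The first conjunct makes the dimension well defined; it excludes the void complex.\<close>

definition pure_of_dim :: "'a set set \<Rightarrow> int \<Rightarrow> bool" where
  "pure_of_dim K d \<longleftrightarrow> facets K \<noteq> {} \<and> (\<forall>F\<in>facets K. face_dim F = d)"

text \<open>The indices of \<open>Fs\<close> start at 0, so the conditions concern all facets but the first.\<close>

definition shelling :: "'a set set \<Rightarrow> 'a set list \<Rightarrow> bool" where
  "shelling K Fs \<longleftrightarrow>
     distinct Fs \<and> set Fs = facets K \<and>
     (\<forall>k. 0 < k \<and> k < length Fs \<longrightarrow>
        pure_of_dim (generated_complex {Fs ! k} \<inter> generated_complex (set (take k Fs)))
          (face_dim (Fs ! k) - 1))"

definition shellable :: "'a set set \<Rightarrow> bool" where
  "shellable K \<longleftrightarrow> (\<exists>Fs. shelling K Fs)"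

section \<open>Block graphs\<close>

text \<open>
  A finite simple graph is a \<^const>\<open>graph\<close>, that is, a finite symmetric digraph without loops
  and parallel arcs. The condition \<^term>\<open>graph H\<close> restricts the digraph subgraphs to subgraphs
  in the undirected sense.

  The null graph is not \<^const>\<open>connected\<close> in the library, so the deletion of the only vertex of
  a one-vertex graph is exempted; hence an isolated vertex is a block.
\<close>

definition is_block :: "('a,'b) pre_digraph \<Rightarrow> ('a,'b) pre_digraph \<Rightarrow> bool" where
  "is_block G B \<longleftrightarrow>
     pre_digraph.max_subgraph G
       (\<lambda>H. graph H \<and> connected H \<and>
            (\<forall>v\<in>verts H. verts H \<noteq> {v} \<longrightarrow> connected (pre_digraph.del_vert H v))) B"

definition block_graph :: "('a,'b) pre_digraph \<Rightarrow> bool" where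
  "block_graph G \<longleftrightarrow> (\<forall>B. is_block G B \<longrightarrow> complete_digraph (card (verts B)) B)"

section \<open>Higher independence complexes\<close>

definition is_component :: "('a,'b) pre_digraph \<Rightarrow> ('a,'b) pre_digraph \<Rightarrow> bool" where
  "is_component G C \<longleftrightarrow> pre_digraph.max_subgraph G connected C"

definition r_independent :: "nat \<Rightarrow> ('a,'b) pre_digraph \<Rightarrow> 'a set \<Rightarrow> bool" where
  "r_independent r G A \<longleftrightarrow>
     A \<subseteq> verts G \<and> (\<forall>C. is_component (G \<restriction> A) C \<longrightarrow> card (verts C) \<le> r)"

definition Ind :: "nat \<Rightarrow> ('a,'b) pre_digraph \<Rightarrow> 'a set set" where
  "Ind r G = {A. r_independent r G A}"

lemma connected_subgraph_in_component:
  assumes fin: "finite (verts G)" "finite (arcs G)"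
    and H: "subgraph H G" "connected H"
  obtains C where "is_component G C" "subgraph H C"
proof -
  define S where "S = {K. subgraph K G \<and> connected K \<and> subgraph H K}"
  define m :: "('a,'b) pre_digraph \<Rightarrow> nat" where "m K = card (verts K) + card (arcs K)" for K
  have "H \<in> S" using H by (auto simp: S_def subgraph_def compatible_def)
  moreover have "\<forall>K. K \<in> S \<longrightarrow> m K < Suc (card (verts G) + card (arcs G))"
    using fin by (auto simp: S_def m_def subgraph_def less_Suc_eq_le intro!: add_mono card_mono)
  ultimately obtain C where C: "C \<in> S" "\<And>K. K \<in> S \<Longrightarrow> m K \<le> m C"
    using ex_has_greatest_nat[of "\<lambda>K. K \<in> S" H m] by blast
  have "K = C" if K: "subgraph C K" "subgraph K G" "connected K" for K
  proof -
    have "K \<in> S" using K C(1) by (auto simp: S_def subgraph_def compatible_def)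
    then have le: "m K \<le> m C" by (rule C(2))
    have sub: "verts C \<subseteq> verts K" "arcs C \<subseteq> arcs K" using K(1) by (auto simp: subgraph_def)
    have f: "finite (verts K)" "finite (arcs K)"
      using K(2) fin by (auto simp: subgraph_def intro: finite_subset)
    have "card (verts C) \<le> card (verts K)" "card (arcs C) \<le> card (arcs K)"
      using sub f by (auto intro: card_mono)
    with le have "card (verts K) \<le> card (verts C)" "card (arcs K) \<le> card (arcs C)"
      by (auto simp: m_def)
    then have "verts C = verts K" "arcs C = arcs K" using sub f by (metis card_seteq)+
    then show "K = C" using K(1)
      by (intro pre_digraph.equality) (auto simp: subgraph_def compatible_def)
  qed
  then have "is_component G C" "subgraph H C"
    using C(1) by (auto simp: is_component_def pre_digraph.max_subgraph_def S_def)
  then show thesis by (rule that)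
qed

lemma simplicial_complex_Ind:
  assumes "graph G"
  shows "simplicial_complex (verts G) (Ind r G)"
proof -
  interpret graph G by fact
  have null: "r_independent r G {}"
    by (auto simp: r_independent_def is_component_def pre_digraph.max_subgraph_def
        subgraph_def connected_def strongly_connected_def)
  have "r_independent r G B" if A: "r_independent r G A" and BA: "B \<subseteq> A" for A B
    unfolding r_independent_def
  proof (intro conjI allI impI)
    have AV: "A \<subseteq> verts G" using A by (simp add: r_independent_def)
    then show "B \<subseteq> verts G" using BA by simp
    fix C assume "is_component (G \<restriction> B) C"
    then have C: "subgraph C (G \<restriction> B)" "connected C"
      by (auto simp: is_component_def pre_digraph.max_subgraph_def)
    have "subgraph C (G \<restriction> A)"
      using C(1) BA by (auto simp: subgraph_def compatible_def wf_digraph_def)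
    moreover have "finite (verts (G \<restriction> A))" "finite (arcs (G \<restriction> A))"
      using AV by (auto intro: finite_subset)
    ultimately obtain D where D: "is_component (G \<restriction> A) D" "subgraph C D"
      using C(2) connected_subgraph_in_component by metis
    then have "verts D \<subseteq> A" "verts C \<subseteq> verts D"
      by (auto simp: is_component_def pre_digraph.max_subgraph_def subgraph_def)
    then have "card (verts C) \<le> card (verts D)"
      using AV finite_verts by (meson card_mono finite_subset)
    also have "\<dots> \<le> r" using A D(1) by (simp add: r_independent_def)
    finally show "card (verts C) \<le> r" .
  qed
  moreover have "r_independent r G A \<Longrightarrow> A \<subseteq> verts G" for A
    by (simp add: r_independent_def)
  ultimately show ?thesis using null finite_verts
    unfolding simplicial_complex_def Ind_def mem_Collect_eq Ball_def by blast
qed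

end

theory Submission
  imports Defs
begin

text \<open>
  The complex is vertex decomposable. To make the induction work, a set \<open>Z\<close> of vertices that must
  be isolated in every face is added to the data; \<open>Ind\<^sub>2\<close> is the case \<open>Z = {}\<close>. Deleting a vertex
  gives a complex of the same kind, and so does the link of a vertex \<open>v\<close>: if \<open>v \<in> Z\<close>, remove the
  closed neighbourhood of \<open>v\<close>; otherwise remove \<open>v\<close> and its neighbours in \<open>Z\<close>, turn the
  other neighbours into a clique, and add them to \<open>Z\<close>. Both operations preserve block graphs.

  A shedding vertex exists unless the complex is a simplex. A vertex of \<open>Z\<close> with a simplicial
  neighbour is shedding, as is the neighbour of a pendant vertex of \<open>Z\<close>, and a vertex with two
  simplicial neighbours either is shedding or leads to the first case. If none of these occurs,
  a leaf block of the graph induced by the non-simplicial vertices has one pendant edge at each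
  of its vertices other than the cut vertex, and the cut vertex is shedding.
\<close>

section \<open>Shedding vertices\<close>

text \<open>The usual exchange form of a shelling order: for distinct facets,
  \<open>Fs ! k - {x}\<close> is the intersection of \<open>Fs ! k\<close> with
  \<open>Fs ! l\<close> and contains that with \<open>Fs ! j\<close>.\<close>

definition shelling_order :: "'a set list \<Rightarrow> bool" where
  "shelling_order Fs \<longleftrightarrow>
     (\<forall>k<length Fs. \<forall>j<k. \<exists>x\<in>Fs ! k - Fs ! j. \<exists>l<k. Fs ! k - {x} \<subseteq> Fs ! l)"

text \<open>Every face of the intersection lies in some \<open>F - {x}\<close> of the intersection,
  and such a set is maximal there because a facet \<open>F\<close> is never contained in an earlier
  one.\<close>

lemma shelling_if_shelling_order:
  assumes "distinct Fs" "set Fs = facets K" "\<And>F. F \<in> K \<Longrightarrow> finite F" "shelling_order Fs"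
  shows "shelling K Fs"
  unfolding shelling_def
proof (intro conjI allI impI)
  fix k assume k: "0 < k \<and> k < length Fs"
  define F where "F = Fs ! k"
  define M where "M = generated_complex {F} \<inter> generated_complex (set (take k Fs))"
  have M_iff: "A \<in> M \<longleftrightarrow> A \<subseteq> F \<and> (\<exists>j<k. A \<subseteq> Fs ! j)" for A
    using k by (auto simp: M_def generated_complex_def nth_image[symmetric])
  have Ff: "F \<in> facets K" using assms(2) k nth_mem unfolding F_def by metis
  then have "F \<in> K" by (simp add: facets_def)
  then have "finite F" by (rule assms(3))
  have max: "\<not> F \<subseteq> Fs ! l" if "l < k" for l
  proof
    assume "F \<subseteq> Fs ! l"
    moreover have "Fs ! l \<in> facets K" using that k assms(2) by (metis less_trans nth_mem)
    ultimately have "Fs ! l = F" using Ff by (auto simp: facets_def)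
    then show False using that k assms(1) by (simp add: F_def nth_eq_iff_index_eq)
  qed
  have ex: "\<exists>x\<in>F. F - {x} \<in> M \<and> A \<subseteq> F - {x}" if A: "A \<in> M" for A
  proof -
    obtain j where j: "j < k" "A \<subseteq> Fs ! j" "A \<subseteq> F" using A unfolding M_iff by blast
    then obtain x l where "x \<in> F - Fs ! j" "l < k" "F - {x} \<subseteq> Fs ! l"
      using assms(4) k unfolding shelling_order_def F_def by meson
    then show ?thesis using j by (intro bexI[of _ x]) (auto simp: M_iff)
  qed
  have facet: "F - {x} \<in> facets M" if "x \<in> F" "F - {x} \<in> M" for x
  proof -
    have "A = F - {x}" if "A \<in> M" "F - {x} \<subseteq> A" for A
    proof -
      have "\<not> F \<subseteq> A" using that(1) max unfolding M_iff by blast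
      then show ?thesis using that M_iff by blast
    qed
    then show ?thesis using that by (auto simp: facets_def)
  qed
  \<comment> \<open>Uses \<open>0 < k\<close>: the intersection is not void, so it has a
    facet.\<close>
  have "{} \<in> M" using k by (auto simp: M_iff)
  then have "facets M \<noteq> {}" using ex facet by blast
  moreover have "face_dim A = face_dim F - 1" if A: "A \<in> facets M" for A
  proof -
    have "A \<in> M" using A by (simp add: facets_def)
    then obtain x where "x \<in> F" "F - {x} \<in> M" "A \<subseteq> F - {x}" using ex by blast
    then have "A = F - {x}" using A by (auto simp: facets_def)
    then have "Suc (card A) = card F" using \<open>x \<in> F\<close> \<open>finite F\<close> card_Suc_Diff1 by metis
    then show ?thesis by (simp add: face_dim_def)
  qed
  ultimately show "pure_of_dim (generated_complex {Fs ! k} \<inter> generated_complex (set (take k Fs)))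
      (face_dim (Fs ! k) - 1)"
    by (simp add: pure_of_dim_def M_def F_def)
qed (use assms in auto)

definition order_shellable :: "'a set set \<Rightarrow> bool" where
  "order_shellable K \<longleftrightarrow> (\<exists>Fs. distinct Fs \<and> set Fs = facets K \<and> shelling_order Fs)"

lemma facet_above:
  assumes "finite K" "A \<in> K"
  obtains F where "F \<in> facets K" "A \<subseteq> F"
proof -
  obtain F where "F \<in> K" "A \<subseteq> F" "\<forall>B\<in>K. F \<subseteq> B \<longrightarrow> F = B"
    using finite_has_maximal2[OF assms] by blast
  then show thesis using that[of F] by (auto simp: facets_def)
qed

definition deletion :: "'a \<Rightarrow> 'a set set \<Rightarrow> 'a set set" where
  "deletion v K = {A \<in> K. v \<notin> A}"

definition link :: "'a \<Rightarrow> 'a set set \<Rightarrow> 'a set set" where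
  "link v K = {A. v \<notin> A \<and> insert v A \<in> K}"

text \<open>The facets of the deletion come first, then those of the link with \<open>v\<close>
  added. By \<open>shed\<close>, no face of the link is a facet of the deletion; hence facets of the
  deletion are facets of \<open>K\<close>.\<close>

lemma order_shellable_shedding:
  assumes "finite K" and down: "\<And>A B. A \<in> K \<Longrightarrow> B \<subseteq> A \<Longrightarrow> B \<in> K"
    and shed: "\<And>A. A \<in> link v K \<Longrightarrow> \<exists>w. w \<noteq> v \<and> w \<notin> A \<and> insert w A \<in> K"
    and "order_shellable (deletion v K)" "order_shellable (link v K)"
  shows "order_shellable K"
proof -
  obtain Ds where Ds: "distinct Ds" "set Ds = facets (deletion v K)" "shelling_order Ds"
    using assms(4) by (auto simp: order_shellable_def)
  obtain Ls where Ls: "distinct Ls" "set Ls = facets (link v K)" "shelling_order Ls"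
    using assms(5) by (auto simp: order_shellable_def)
  have vD: "v \<notin> D" if "D \<in> set Ds" for D using that Ds(2) by (auto simp: facets_def deletion_def)
  have vL: "v \<notin> L" "insert v L \<in> K" if "L \<in> set Ls" for L
    using that Ls(2) by (auto simp: facets_def link_def)
  have "facets (deletion v K) \<subseteq> facets K"
  proof
    fix F assume F: "F \<in> facets (deletion v K)"
    then have FK: "F \<in> K" "v \<notin> F" by (auto simp: facets_def deletion_def)
    have "F' = F" if F': "F' \<in> K" "F \<subseteq> F'" for F'
    proof (cases "v \<in> F'")
      case True
      then have "insert v F \<in> K" using F' down by blast
      then obtain w where w: "w \<noteq> v" "w \<notin> F" "insert w F \<in> K"
        using shed FK by (auto simp: link_def)
      then have "insert w F = F" using F FK by (auto simp: facets_def deletion_def)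
      then show ?thesis using w by auto
    qed (use F F' in \<open>auto simp: facets_def deletion_def\<close>)
    then show "F \<in> facets K" using FK by (auto simp: facets_def)
  qed
  moreover have "insert v ` facets (link v K) \<subseteq> facets K"
  proof
    fix F assume "F \<in> insert v ` facets (link v K)"
    then obtain L where L: "F = insert v L" "L \<in> facets (link v K)" by blast
    have "F' = F" if F': "F' \<in> K" "F \<subseteq> F'" for F'
    proof -
      have "F' - {v} \<in> link v K" "L \<subseteq> F' - {v}"
        using F' L by (auto simp: link_def facets_def insert_absorb)
      then have "F' - {v} = L" using L(2) by (auto simp: facets_def)
      then show ?thesis using F' L by auto
    qed
    then show "F \<in> facets K" using L by (auto simp: facets_def link_def)
  qed
  moreover have "F \<in> facets (deletion v K) \<union> insert v ` facets (link v K)" if F: "F \<in> facets K" for F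
  proof (cases "v \<in> F")
    case True
    have "L = F - {v}" if "L \<in> link v K" "F - {v} \<subseteq> L" for L
    proof -
      have "insert v L = F" using F that True by (auto simp: facets_def link_def)
      then show ?thesis using that by (auto simp: link_def)
    qed
    moreover have "F - {v} \<in> link v K" using F True by (auto simp: facets_def link_def insert_absorb)
    ultimately have "F - {v} \<in> facets (link v K)" by (auto simp: facets_def)
    moreover have "F = insert v (F - {v})" using True by auto
    ultimately show ?thesis by blast
  qed (use F in \<open>auto simp: facets_def deletion_def\<close>)
  ultimately have set: "set (Ds @ map (insert v) Ls) = facets K"
    using Ds(2) Ls(2) by auto
  have "inj_on (insert v) (set Ls)" by (rule inj_onI) (metis insert_ident vL(1))
  then have dist: "distinct (Ds @ map (insert v) Ls)"
    using Ds(1) Ls(1) vD by (auto simp: distinct_map)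
  have "shelling_order (Ds @ map (insert v) Ls)" (is "shelling_order ?Fs")
    unfolding shelling_order_def
  proof (intro allI impI)
    fix k j assume k: "k < length ?Fs" and j: "j < k"
    show "\<exists>x\<in>?Fs ! k - ?Fs ! j. \<exists>l<k. ?Fs ! k - {x} \<subseteq> ?Fs ! l"
    proof (cases "k < length Ds")
      case True
      then show ?thesis using Ds(3) j unfolding shelling_order_def
        by (fastforce simp: nth_append)
    next
      case False
      define i where "i = k - length Ds"
      have i: "i < length Ls" "k = length Ds + i" using k False by (auto simp: i_def)
      have Fk: "?Fs ! k = insert v (Ls ! i)" using i by (simp add: nth_append)
      have vi: "v \<notin> Ls ! i" "insert v (Ls ! i) \<in> K" using i vL by auto
      show ?thesis
      proof (cases "j < length Ds")
        case True
        \<comment> \<open>Dropping \<open>v\<close> leaves a face of the deletion. A facet of the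
          deletion above it comes earlier in the list, so \<open>x = v\<close> works.\<close>
        have "Ls ! i \<in> deletion v K" using vi down by (auto simp: deletion_def)
        moreover have "finite (deletion v K)" using assms(1) by (simp add: deletion_def)
        ultimately obtain D where "D \<in> set Ds" "Ls ! i \<subseteq> D"
          using facet_above Ds(2) by metis
        then obtain l where "l < length Ds" "Ls ! i \<subseteq> Ds ! l" by (metis in_set_conv_nth)
        then have "l < k" "?Fs ! k - {v} \<subseteq> ?Fs ! l" using Fk i by (auto simp: nth_append)
        moreover have "v \<in> ?Fs ! k - ?Fs ! j" using Fk True vD by (auto simp: nth_append)
        ultimately show ?thesis by blast
      next
        case False
        define m where "m = j - length Ds"
        have m: "m < i" "?Fs ! j = insert v (Ls ! m)"
          using False j i by (auto simp: m_def nth_append)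
        obtain x l where x: "x \<in> Ls ! i - Ls ! m" "l < i" "Ls ! i - {x} \<subseteq> Ls ! l"
          using Ls(3) i(1) m(1) unfolding shelling_order_def by meson
        then have "?Fs ! (length Ds + l) = insert v (Ls ! l)" using i by (simp add: nth_append)
        moreover have "x \<noteq> v" using x vi by auto
        ultimately show ?thesis using x m Fk i
          by (intro bexI[of _ x] exI[of _ "length Ds + l"]) auto
      qed
    qed
  qed
  then show ?thesis using set dist unfolding order_shellable_def by blast
qed


section \<open>Block graphs as a hereditary class of relations\<close>

text \<open>Connectivity in the subgraph induced on \<open>S\<close>. The empty walk is allowed even
  outside \<open>S\<close>, which is why \<open>reach_in\<close> and
  \<open>reach_obtain_path\<close> assume \<open>x \<in> S\<close>.\<close>

definition reach :: "('a \<Rightarrow> 'a \<Rightarrow> bool) \<Rightarrow> 'a set \<Rightarrow> 'a \<Rightarrow> 'a \<Rightarrow> bool" where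
  "reach E S = (\<lambda>a b. a \<in> S \<and> b \<in> S \<and> E a b)\<^sup>*\<^sup>*"

lemma reach_refl [simp]: "reach E S x x"
  by (simp add: reach_def)

lemma reach_adj: "E x y \<Longrightarrow> x \<in> S \<Longrightarrow> y \<in> S \<Longrightarrow> reach E S x y"
  by (auto simp: reach_def)

lemma reach_trans: "reach E S x y \<Longrightarrow> reach E S y z \<Longrightarrow> reach E S x z"
  unfolding reach_def by (rule rtranclp_trans)

lemma reach_mono: "reach E S x y \<Longrightarrow> S \<subseteq> T \<Longrightarrow> reach E T x y"
  unfolding reach_def by (erule rtranclp_mono[THEN predicate2D, rotated]) auto

lemma reach_sym:
  assumes "\<forall>a b. E a b \<longrightarrow> E b a" "reach E S x y"
  shows "reach E S y x"
  using assms(2) unfolding reach_def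
  by (induction rule: rtranclp_induct) (use assms(1) in \<open>auto intro: converse_rtranclp_into_rtranclp\<close>)

lemma reach_in: "reach E S x y \<Longrightarrow> x \<in> S \<Longrightarrow> y \<in> S"
  unfolding reach_def by (induction rule: rtranclp_induct) auto

lemma reach_exit:
  assumes "reach E S x y" "P x" "\<not> P y"
  shows "\<exists>a b. reach E S x a \<and> a \<in> S \<and> b \<in> S \<and> E a b \<and> P a \<and> \<not> P b"
proof -
  have "P y \<or> (\<exists>a b. reach E S x a \<and> a \<in> S \<and> b \<in> S \<and> E a b \<and> P a \<and> \<not> P b)"
    using assms(1) unfolding reach_def
    by (induction rule: rtranclp_induct) (use assms(2) in blast)+
  then show ?thesis using assms(3) by blast
qed

lemma reach_subst:
  assumes "reach E S x y" "\<And>a b. a \<in> S \<Longrightarrow> b \<in> S \<Longrightarrow> E a b \<Longrightarrow> reach E' S' a b"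
  shows "reach E' S' x y"
  using assms(1) unfolding reach_def[of E S]
  by (induction rule: rtranclp_induct) (auto intro: reach_trans assms(2))

text \<open>
  The last axiom characterises block graphs: two neighbours of \<open>r\<close> in the same component of
  \<open>V - {r}\<close> lie with \<open>r\<close> on a cycle, hence in a common block.
\<close>

locale block_relation =
  fixes V :: "'a set" and E :: "'a \<Rightarrow> 'a \<Rightarrow> bool"
  assumes finite_V: "finite V"
    and sym: "E x y \<Longrightarrow> E y x"
    and irrefl: "\<not> E x x"
    and neighbours_adj: "r \<in> V \<Longrightarrow> x \<in> V \<Longrightarrow> y \<in> V \<Longrightarrow> E r x \<Longrightarrow> E r y \<Longrightarrow> x \<noteq> y \<Longrightarrow>
      reach E (V - {r}) x y \<Longrightarrow> E x y"
begin

lemma restrict: "W \<subseteq> V \<Longrightarrow> block_relation W E"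
proof
  fix r x y assume "W \<subseteq> V" "r \<in> W" "x \<in> W" "y \<in> W" "E r x" "E r y" "x \<noteq> y" "reach E (W - {r}) x y"
  moreover have "W - {r} \<subseteq> V - {r}" using \<open>W \<subseteq> V\<close> by blast
  ultimately show "E x y" using neighbours_adj reach_mono by (metis subsetD)
qed (use finite_V sym irrefl in \<open>auto intro: finite_subset\<close>)

lemma reach_commute: "reach E S x y \<Longrightarrow> reach E S y x"
  using reach_sym sym by metis

text \<open>Block graphs have no induced 4-cycle: \<open>a\<close> and \<open>d\<close> are
  neighbours of \<open>b\<close> that are joined through \<open>c\<close> in
  \<open>V - {b}\<close>.\<close>

lemma square:
  assumes "{a, b, c, d} \<subseteq> V" "E a b" "E a c" "E d b" "E d c" "b \<noteq> c" "a \<noteq> d"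
  shows "E a d"
proof -
  have "reach E (V - {b}) a c" "reach E (V - {b}) c d"
    using assms irrefl sym by (auto intro!: reach_adj)
  then have "reach E (V - {b}) a d" by (rule reach_trans)
  then show ?thesis using neighbours_adj[of b a d] assms sym by auto
qed

text \<open>Prepares the link of \<open>v\<close>. A new edge can be replaced by a walk through
  \<open>v\<close>, so connections avoiding \<open>r\<close> exist in \<open>E\<close> already. If
  both edges at \<open>r\<close> are old, the axiom applies; otherwise \<open>x\<close> and
  \<open>y\<close> both turn out to be neighbours of \<open>v\<close>, and these form a clique in
  \<open>E'\<close>.\<close>

lemma contract:
  fixes v defines "E' \<equiv> \<lambda>x y. E x y \<or> E v x \<and> E v y \<and> x \<noteq> y"
  assumes "v \<in> V"
  shows "block_relation (V - {v}) E'"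
proof
  fix r x y
  assume r: "r \<in> V - {v}" "x \<in> V - {v}" "y \<in> V - {v}" "E' r x" "E' r y" "x \<noteq> y"
    and reach': "reach E' (V - {v} - {r}) x y"
  have step: "reach E (V - {r}) a b" if "a \<in> V - {v} - {r}" "b \<in> V - {v} - {r}" "E' a b" for a b
  proof (cases "E a b")
    case True
    then show ?thesis using that by (intro reach_adj) auto
  next
    case False
    then have "E a v" "E v b" using that sym by (auto simp: E'_def)
    then have "reach E (V - {r}) a v" "reach E (V - {r}) v b"
      using that r \<open>v \<in> V\<close> by (auto intro!: reach_adj)
    then show ?thesis by (rule reach_trans)
  qed
  have reach: "reach E (V - {r}) x y"
    using reach' step by (rule reach_subst)
  \<comment> \<open>Here \<open>p\<close> and \<open>v\<close> are neighbours of \<open>r\<close>,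
    and \<open>p\<close> reaches \<open>v\<close> through \<open>q\<close> while avoiding
    \<open>r\<close>.\<close>
  have vx: "E v p" if "E v r" "E v q" "E r p" "reach E (V - {r}) p q" "p \<in> V - {v}" "q \<in> V - {r}" for p q
  proof -
    have "reach E (V - {r}) q v" using that r sym irrefl \<open>v \<in> V\<close> by (intro reach_adj) auto
    then have "reach E (V - {r}) p v" using that(4) reach_trans by metis
    then have "E p v" using neighbours_adj[of r p v] that r \<open>v \<in> V\<close> sym[of v r] by blast
    then show ?thesis by (rule sym)
  qed
  have "x \<noteq> r" "y \<noteq> r" using r irrefl by (auto simp: E'_def)
  show "E' x y"
  proof (cases "E r x \<and> E r y")
    case True
    then show ?thesis using neighbours_adj[of r x y] r reach by (auto simp: E'_def)
  next
    case False
    then have "E v r" "E v x \<or> E v y" using r(4,5) by (auto simp: E'_def)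
    have "E v x \<and> E v y"
    proof (cases "E v x")
      case True
      have "E v y" if "E r y"
        using vx[OF \<open>E v r\<close> True that reach_commute[OF reach]] r \<open>x \<noteq> r\<close> by blast
      then show ?thesis using True r(5) by (auto simp: E'_def)
    next
      case False
      then have "E v y" "E r x" using \<open>E v x \<or> E v y\<close> r(4) by (auto simp: E'_def)
      then show ?thesis using vx[OF \<open>E v r\<close> \<open>E v y\<close> \<open>E r x\<close> reach] r \<open>y \<noteq> r\<close> by blast
    qed
    then show ?thesis using r by (simp add: E'_def)
  qed
qed (use finite_V sym irrefl in \<open>auto simp: E'_def\<close>)

text \<open>
  The leaf block consists of \<open>e\<close> and a component of \<open>V - {e}\<close> that is as small as possible,
  over all \<open>e\<close>, among those meeting the neighbourhood of \<open>e\<close>.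
\<close>

lemma leaf_block:
  assumes "\<exists>x\<in>V. \<exists>y\<in>V. E x y"
  obtains D e where "D \<subseteq> V" "e \<in> D" "D \<noteq> {e}"
    "\<And>x y. x \<in> D \<Longrightarrow> y \<in> D \<Longrightarrow> x \<noteq> y \<Longrightarrow> E x y"
    "\<And>x y. x \<in> D - {e} \<Longrightarrow> y \<in> V \<Longrightarrow> E x y \<Longrightarrow> y \<in> D"
proof -
  define C where "C r y = {z. reach E (V - {r}) y z}" for r y
  define P where "P = (\<lambda>(r, y). r \<in> V \<and> y \<in> V \<and> E r y)"
  have "\<exists>p. P p" using assms by (auto simp: P_def)
  then obtain p where p: "P p" "\<And>q. P q \<Longrightarrow> card (case_prod C p) \<le> card (case_prod C q)"
    using ex_has_least_nat[of P _ "\<lambda>p. card (case_prod C p)"] by metis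
  obtain r y where ry: "p = (r, y)" by fastforce
  have r: "r \<in> V" "y \<in> V" "E r y" using p(1) by (auto simp: ry P_def)
  have sub: "C r' y' \<subseteq> V - {r'}" if "P (r', y')" for r' y'
    using that irrefl reach_in[of E "V - {r'}" y'] by (auto simp: C_def P_def)
  have Csub: "C r y \<subseteq> V - {r}" using sub p(1) ry by simp
  \<comment> \<open>A vertex of \<open>C r y\<close> not adjacent to \<open>r\<close> yields an edge
    from \<open>a\<close> to \<open>b\<close> leaving the neighbourhood of \<open>r\<close>. Then
    \<open>C a b\<close> omits \<open>a\<close> and lies strictly inside \<open>C r y\<close>,
    against minimality.\<close>
  have adj: "E r z" if z: "z \<in> C r y" for z
  proof (rule ccontr)
    assume "\<not> E r z"
    then obtain a b where ab: "reach E (V - {r}) y a" "a \<in> V - {r}" "b \<in> V - {r}" "E a b"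
        "E r a" "\<not> E r b"
      using reach_exit[of E "V - {r}" y z "E r"] z r(3) unfolding C_def mem_Collect_eq by blast
    \<comment> \<open>Otherwise \<open>b\<close> and \<open>r\<close> would be neighbours of
      \<open>a\<close> in one component of \<open>V - {a}\<close>, hence adjacent.\<close>
    have br: "\<not> reach E (V - {a}) b r"
      using neighbours_adj[of a b r] ab r sym by blast
    \<comment> \<open>A walk from \<open>b\<close> avoiding \<open>a\<close> cannot meet
      \<open>r\<close>, so it is also a walk in \<open>V - {r}\<close>.\<close>
    have nr: "reach E (V - {r}) b w" if "reach E (V - {a}) b w" for w
      using that unfolding reach_def[of E "V - {a}"]
    proof (induction rule: rtranclp_induct)
      case (step w w')
      have "reach E (V - {a}) b w'"
        using step(1,2) unfolding reach_def by (auto intro: rtranclp.rtrancl_into_rtrancl)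
      then have "w' \<noteq> r" using br by blast
      moreover have "w \<in> V - {r}" using step.IH ab(3) reach_in by metis
      ultimately show ?case using step by (auto intro: reach_trans reach_adj)
    qed simp
    have "reach E (V - {r}) y b" using ab by (meson reach_adj reach_trans)
    then have "C a b \<subseteq> C r y" using nr reach_trans by (fastforce simp: C_def)
    moreover have "a \<in> C r y" using ab by (simp add: C_def)
    moreover have "P (a, b)" using ab by (simp add: P_def)
    then have "a \<notin> C a b" using sub by blast
    ultimately have "C a b \<subset> C r y" by blast
    moreover have "finite (C r y)" using Csub finite_V by (meson finite_Diff finite_subset)
    ultimately have "card (C a b) < card (C r y)" by (simp add: psubset_card_mono)
    then show False using p(2)[OF \<open>P (a, b)\<close>] by (simp add: ry)
  qed
  have clique: "E x z" if "x \<in> C r y" "z \<in> C r y" "x \<noteq> z" for x z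
  proof -
    have "reach E (V - {r}) x z"
      using that(1,2) reach_trans[OF reach_commute] unfolding C_def mem_Collect_eq by metis
    then show ?thesis using neighbours_adj[of r x z] that adj Csub r by blast
  qed
  show thesis
  proof (rule that[of "insert r (C r y)" r])
    have "y \<in> C r y" "y \<noteq> r" using r irrefl by (auto simp: C_def)
    then show "insert r (C r y) \<noteq> {r}" by blast
    show "E x z" if "x \<in> insert r (C r y)" "z \<in> insert r (C r y)" "x \<noteq> z" for x z
      using that adj clique sym by blast
    show "z \<in> insert r (C r y)" if "x \<in> insert r (C r y) - {r}" "z \<in> V" "E x z" for x z
    proof (cases "z = r")
      case False
      have "reach E (V - {r}) x z" using that False Csub by (intro reach_adj) auto
      then show ?thesis using that reach_trans[of E "V - {r}" y x z] by (auto simp: C_def)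
    qed simp
  qed (use Csub r in auto)
qed

end


section \<open>The generalised complexes\<close>

text \<open>Components of at most two vertices are expressed as degree at most one inside
  \<open>A\<close>. \<open>Z\<close> is not confined to \<open>V\<close>, so a deletion leaves it as
  it is.\<close>

definition faces :: "'a set \<Rightarrow> ('a \<Rightarrow> 'a \<Rightarrow> bool) \<Rightarrow> 'a set \<Rightarrow> 'a set set" where
  "faces V E Z = {A. A \<subseteq> V \<and> (\<forall>u\<in>A. \<forall>a\<in>A. E u a \<longrightarrow> u \<notin> Z \<and> (\<forall>b\<in>A. E u b \<longrightarrow> b = a))}"

lemma faces_subset: "A \<in> faces V E Z \<Longrightarrow> A \<subseteq> V"
  by (simp add: faces_def)

lemma faces_down: "A \<in> faces V E Z \<Longrightarrow> B \<subseteq> A \<Longrightarrow> B \<in> faces V E Z"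
  unfolding faces_def by blast

lemma deletion_faces: "deletion v (faces V E Z) = faces (V - {v}) E Z"
  by (auto simp: deletion_def faces_def)

context block_relation
begin

lemma link_faces_in:
  assumes "v \<in> V" "v \<in> Z"
  shows "link v (faces V E Z) = faces (V - {v} - {u. E v u}) E Z"
  using assms irrefl sym unfolding link_def faces_def by blast

text \<open>Beside \<open>v\<close>, a face may keep one neighbour of \<open>v\<close>, outside
  \<open>Z\<close> and with no further neighbour in the face. Putting the neighbours into
  \<open>Z\<close> makes them isolated, and the clique edges then exclude having two of them. Those
  already in \<open>Z\<close> cannot accompany \<open>v\<close> at all.\<close>

lemma link_faces_notin:
  assumes "v \<in> V" "v \<notin> Z"
  shows "link v (faces V E Z) =
    faces (V - {v} - {u \<in> Z. E v u}) (\<lambda>x y. E x y \<or> E v x \<and> E v y \<and> x \<noteq> y) (Z \<union> {u. E v u})"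
    (is "_ = faces ?V ?E ?Z")
proof (intro equalityI subsetI)
  fix A assume "A \<in> link v (faces V E Z)"
  then have v: "v \<notin> A" and A: "insert v A \<in> faces V E Z" by (auto simp: link_def)
  have *: "u \<notin> Z \<and> b = a" if "u \<in> insert v A" "a \<in> insert v A" "b \<in> insert v A" "E u a" "E u b"
    for u a b using A that unfolding faces_def by blast
  have no: "\<not> E v u" if "u \<in> A" "a \<in> A" "E u a" for u a
    using *[of u a v] that v sym by blast
  have E_eq: "?E u a \<longleftrightarrow> E u a" if "u \<in> A" "a \<in> A" for u a
    using *[of v u a] that by blast
  show "A \<in> faces ?V ?E ?Z"
    unfolding faces_def mem_Collect_eq
  proof (intro conjI ballI impI subsetI)
    show "x \<in> ?V" if "x \<in> A" for x
      using that v faces_subset[OF A] *[of x v v] sym[of v x] by blast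
    fix u a assume ua: "u \<in> A" "a \<in> A" "?E u a"
    then have "E u a" using E_eq by blast
    then show "u \<notin> ?Z" using ua *[of u a a] no by blast
    fix b assume "b \<in> A" "?E u b"
    then show "b = a" using ua \<open>E u a\<close> E_eq *[of u a b] by blast
  qed
next
  fix A assume A: "A \<in> faces ?V ?E ?Z"
  then have sub: "A \<subseteq> ?V" by (simp add: faces_def)
  have *: "u \<notin> Z \<and> \<not> E v u \<and> b = a" if "u \<in> A" "a \<in> A" "b \<in> A" "?E u a" "?E u b" for u a b
    using A that unfolding faces_def by blast
  have "insert v A \<in> faces V E Z"
    unfolding faces_def mem_Collect_eq
  proof (intro conjI ballI impI)
    show "insert v A \<subseteq> V" using sub assms by blast
    fix u a assume ua: "u \<in> insert v A" "a \<in> insert v A" "E u a"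
    show "u \<notin> Z"
    proof (cases "u = v \<or> a = v")
      case True
      then show ?thesis using ua sub assms sym[of u a] by blast
    qed (use ua *[of u a a] in auto)
    fix b assume b: "b \<in> insert v A" "E u b"
    consider "u = v" | "u \<in> A" "a = v" | "u \<in> A" "b = v" | "u \<in> A" "a \<in> A" "b \<in> A" using ua b by blast
    then show "b = a"
    proof cases
      \<comment> \<open>Distinct neighbours \<open>a\<close> and \<open>b\<close> of
        \<open>v\<close> would be joined by an added edge although both lie in the enlarged
        \<open>Z\<close>.\<close>
      case 1
      then show ?thesis using ua b irrefl[of v] *[of a b b] by blast
    next
      case 2
      then show ?thesis using b ua sym[of u a] *[of u b b] by blast
    next
      case 3
      then show ?thesis using b ua sym[of u b] *[of u a a] by blast
    qed (use * ua b in blast)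
  qed
  then show "A \<in> link v (faces V E Z)" using sub by (auto simp: link_def)
qed

section \<open>Criteria for shedding vertices\<close>

definition simplicial :: "'a \<Rightarrow> bool" where
  "simplicial s \<longleftrightarrow> s \<in> V \<and> (\<forall>x\<in>V. \<forall>y\<in>V. E s x \<longrightarrow> E s y \<longrightarrow> x \<noteq> y \<longrightarrow> E x y)"

definition shedding :: "'a set \<Rightarrow> 'a \<Rightarrow> bool" where
  "shedding Z v \<longleftrightarrow> v \<in> V \<and>
     (\<forall>A. A \<in> link v (faces V E Z) \<longrightarrow> (\<exists>w. w \<noteq> v \<and> w \<notin> A \<and> insert w A \<in> faces V E Z))"

lemma insert_isolated:
  assumes "A \<in> faces V E Z" "w \<in> V" "\<And>a. a \<in> A \<Longrightarrow> \<not> E w a"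
  shows "insert w A \<in> faces V E Z"
  using assms sym irrefl unfolding faces_def by blast

text \<open>With \<open>insert_isolated\<close>, one of the two ways to find the vertex
  \<open>w\<close> of a shedding argument: \<open>w\<close> may pair up with a vertex so far
  isolated in the face.\<close>

lemma insert_pendant:
  assumes "A \<in> faces V E Z" "w \<in> V" "w \<notin> Z" "a \<in> A" "a \<notin> Z"
    and "\<And>b. b \<in> A \<Longrightarrow> E w b \<Longrightarrow> b = a" "\<And>b. b \<in> A \<Longrightarrow> \<not> E a b"
  shows "insert w A \<in> faces V E Z"
proof -
  have *: "u \<notin> Z \<and> b = c" if "u \<in> A" "c \<in> A" "b \<in> A" "E u c" "E u b" for u b c
    using assms(1) that unfolding faces_def by blast
  have "insert w A \<subseteq> V" using assms(1,2) faces_subset by blast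
  moreover have "u \<notin> Z \<and> b = c"
    if "u \<in> insert w A" "c \<in> insert w A" "b \<in> insert w A" "E u c" "E u b" for u b c
    using that assms(2-) * sym irrefl by (metis insert_iff)
  ultimately show ?thesis unfolding faces_def by blast
qed

lemma link_facesD:
  assumes "A \<in> link v (faces V E Z)"
  shows "v \<notin> A" "A \<in> faces V E Z" "A \<subseteq> V"
    "\<And>a. a \<in> A \<Longrightarrow> E v a \<Longrightarrow> v \<notin> Z \<and> a \<notin> Z"
    "\<And>a b. a \<in> A \<Longrightarrow> b \<in> A \<Longrightarrow> E v a \<Longrightarrow> E v b \<Longrightarrow> a = b"
    "\<And>a b. a \<in> A \<Longrightarrow> b \<in> A \<Longrightarrow> E v a \<Longrightarrow> \<not> E a b"
proof -
  have v: "v \<notin> A" and A: "insert v A \<in> faces V E Z" using assms by (auto simp: link_def)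
  have *: "u \<notin> Z \<and> b = a" if "u \<in> insert v A" "a \<in> insert v A" "b \<in> insert v A" "E u a" "E u b"
    for u a b using A that unfolding faces_def by blast
  show "v \<notin> A" by fact
  show "A \<in> faces V E Z" using A faces_down by blast
  then show "A \<subseteq> V" by (rule faces_subset)
  show "v \<notin> Z \<and> a \<notin> Z" if "a \<in> A" "E v a" for a using *[of v a a] *[of a v v] that sym by blast
  show "a = b" if "a \<in> A" "b \<in> A" "E v a" "E v b" for a b using *[of v a b] that by blast
  show "\<not> E a b" if "a \<in> A" "b \<in> A" "E v a" for a b using *[of a v b] that sym v by blast
qed

text \<open>As \<open>v\<close> lies in \<open>Z\<close>, a face of its link contains no neighbour
  of \<open>v\<close>. The other neighbours of \<open>s\<close> are neighbours of \<open>v\<close>,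
  so \<open>s\<close> can be added as an isolated vertex.\<close>

lemma shedding_if_simplicial_neighbour:
  assumes "simplicial s" "E s v" "v \<in> V" "v \<in> Z"
  shows "shedding Z v"
  unfolding shedding_def
proof (intro conjI allI impI)
  fix A assume A: "A \<in> link v (faces V E Z)"
  note D = link_facesD[OF A]
  have "s \<notin> A" using D(4) assms sym by blast
  moreover have "\<not> E s a" if "a \<in> A" for a
    using assms D(1,3) D(4)[of a] that unfolding simplicial_def by blast
  then have "insert s A \<in> faces V E Z"
    using insert_isolated D(2) assms(1) by (simp add: simplicial_def)
  moreover have "s \<noteq> v" using assms irrefl by blast
  ultimately show "\<exists>w. w \<noteq> v \<and> w \<notin> A \<and> insert w A \<in> faces V E Z" by blast
qed fact

text \<open>A face of the link of \<open>c\<close> contains neither \<open>s\<close>, because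
  \<open>s\<close> lies in \<open>Z\<close>, nor \<open>c\<close>, the only neighbour of
  \<open>s\<close>. So \<open>s\<close> can be added as an isolated vertex.\<close>

lemma shedding_if_pendant:
  assumes "s \<in> V" "s \<in> Z" "c \<in> V" "E s c" "\<And>y. y \<in> V \<Longrightarrow> E s y \<Longrightarrow> y = c"
  shows "shedding Z c"
  unfolding shedding_def
proof (intro conjI allI impI)
  fix A assume A: "A \<in> link c (faces V E Z)"
  note D = link_facesD[OF A]
  have "s \<notin> A" using D(4) assms sym by blast
  moreover have "\<not> E s a" if "a \<in> A" for a
    using assms(5) D(1,3) that by blast
  then have "insert s A \<in> faces V E Z"
    using insert_isolated D(2) assms(1) by simp
  moreover have "s \<noteq> c" using assms irrefl by blast
  ultimately show "\<exists>w. w \<noteq> c \<and> w \<notin> A \<and> insert w A \<in> faces V E Z" by blast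
qed fact

text \<open>If no vertex of \<open>Z\<close> has a simplicial neighbour, \<open>c\<close> itself is
  shedding: in a face of its link, neighbours of \<open>s\<close> or \<open>t\<close> are neighbours
  of \<open>c\<close>, so there is at most one, and \<open>s\<close> or \<open>t\<close> can be
  added.\<close>

lemma shedding_if_two_simplicial_neighbours:
  assumes c: "c \<in> V" and s: "simplicial s" "E c s" and t: "simplicial t" "E c t" and "s \<noteq> t"
  shows "\<exists>v. shedding Z v"
proof (cases "\<exists>z u. simplicial u \<and> E u z \<and> z \<in> V \<and> z \<in> Z")
  case True
  then show ?thesis using shedding_if_simplicial_neighbour by blast
next
  case False
  have V: "s \<in> V" "t \<in> V" using s t by (auto simp: simplicial_def)
  have "shedding Z c"
    unfolding shedding_def
  proof (intro conjI allI impI)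
    fix A assume A: "A \<in> link c (faces V E Z)"
    note D = link_facesD[OF A]
    have nbr: "E c a" if "a \<in> A" "E s a \<or> E t a" for a
      using that s t sym c D(1,3) unfolding simplicial_def by blast
    have "\<exists>w\<in>{s, t}. w \<notin> A \<and> insert w A \<in> faces V E Z"
    proof (cases "\<exists>a\<in>A. E c a")
      case True
      then obtain a where a: "a \<in> A" "E c a" by blast
      have aV: "a \<in> V" "a \<noteq> c" using a D(1,3) by auto
      have uniq: "b = a" if "b \<in> A" "E s b \<or> E t b" for b
        using D(5) a that nbr by blast
      have add: "insert w A \<in> faces V E Z" if "w \<in> {s, t}" "\<not> E w a \<or> w \<notin> Z" for w
      proof (cases "E w a")
        case True
        have "w \<in> V" "w \<notin> Z" using that True V by auto
        moreover have "a \<notin> Z" using D(4) a by blast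
        moreover have "b = a" if "b \<in> A" "E w b" for b using uniq \<open>w \<in> {s, t}\<close> that by blast
        moreover have "\<not> E a b" if "b \<in> A" for b using D(6) a that by blast
        ultimately show ?thesis using insert_pendant[OF D(2)] a(1) by blast
      next
        case False
        then show ?thesis using insert_isolated[OF D(2)] V that uniq by blast
      qed
      show ?thesis
      proof (cases "a = s \<or> a = t")
        case True
        then obtain w where w: "w \<in> {s, t}" "w \<noteq> a" using \<open>s \<noteq> t\<close> by blast
        have "w \<notin> A" using w D(5) a s t by blast
        moreover have "w \<notin> Z" if "E w a" using False that w V True s(1) t(1) sym by blast
        ultimately show ?thesis using add w by blast
      next
        case ne: False
        then have "s \<notin> A" "t \<notin> A" using D(5) a s t by blast+
        \<comment> \<open>Otherwise \<open>s\<close>, \<open>a\<close>, \<open>t\<close>,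
          \<open>c\<close> form a 4-cycle, so \<open>s\<close> and \<open>t\<close> are adjacent,
          and \<open>s\<close> in \<open>Z\<close> has a simplicial neighbour, which is excluded
          here.\<close>
        moreover have "\<not> E s a \<or> s \<notin> Z \<or> \<not> E t a"
        proof (rule ccontr)
          assume "\<not> (\<not> E s a \<or> s \<notin> Z \<or> \<not> E t a)"
          then have "E s t" "s \<in> Z"
            using square[of s a c t] aV V c s t sym \<open>s \<noteq> t\<close> by auto
          then show False using False V t sym by blast
        qed
        ultimately show ?thesis using add by blast
      qed
    next
      case no: False
      have "s \<notin> A" using no s by blast
      moreover have "insert s A \<in> faces V E Z"
        using insert_isolated[OF D(2) V(1)] no nbr by blast
      ultimately show ?thesis by blast
    qed
    then show "\<exists>w. w \<noteq> c \<and> w \<notin> A \<and> insert w A \<in> faces V E Z"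
      using s t irrefl[of c] by auto
  qed fact
  then show ?thesis ..
qed

text \<open>If a face of the link of \<open>e\<close> contains some \<open>x\<close> of the clique
  \<open>D\<close>, then \<open>x\<close> is isolated in it and \<open>q x\<close> can be paired
  with it. If the face misses \<open>D\<close>, then at any \<open>c\<close> in
  \<open>D - {e}\<close> either \<open>q c\<close> can be added as an isolated vertex or
  \<open>c\<close> as the partner of \<open>q c\<close>.\<close>

lemma shedding_if_pendant_block:
  assumes D: "D \<subseteq> V" "e \<in> D" "D \<noteq> {e}" "\<And>x y. x \<in> D \<Longrightarrow> y \<in> D \<Longrightarrow> x \<noteq> y \<Longrightarrow> E x y"
    and q: "\<And>x. x \<in> D - {e} \<Longrightarrow> q x \<in> V - D \<and> E x (q x) \<and> x \<notin> Z \<and> q x \<notin> Z"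
    and N: "\<And>x y. x \<in> D - {e} \<Longrightarrow> y \<in> V \<Longrightarrow> E x y \<Longrightarrow> y \<in> D \<or> y = q x"
    and Nq: "\<And>x y. x \<in> D - {e} \<Longrightarrow> y \<in> V \<Longrightarrow> E (q x) y \<Longrightarrow> y = x"
  shows "shedding Z e"
  unfolding shedding_def
proof (intro conjI allI impI)
  show "e \<in> V" using D by blast
  fix A assume A: "A \<in> link e (faces V E Z)"
  note F = link_facesD[OF A]
  show "\<exists>w. w \<noteq> e \<and> w \<notin> A \<and> insert w A \<in> faces V E Z"
  proof (cases "A \<inter> D = {}")
    case True
    obtain c where c: "c \<in> D - {e}" using D by blast
    show ?thesis
    proof (cases "q c \<in> A")
      case False
      have "insert (q c) A \<in> faces V E Z"
        using insert_isolated[OF F(2), of "q c"] q[OF c] Nq[OF c] F(3) True c by blast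
      moreover have "q c \<noteq> e" using q[OF c] D by blast
      ultimately show ?thesis using False by blast
    next
      case qA: True
      have "insert c A \<in> faces V E Z"
        by (rule insert_pendant[OF F(2), of c "q c"])
           (use c D(1) q[OF c] qA N[OF c] Nq[OF c] F(3) True in blast)+
      then show ?thesis using c True by blast
    qed
  next
    case False
    then obtain x where x: "x \<in> A" "x \<in> D - {e}" using F(1) by blast
    have "E e x" using x D by blast
    then have no: "\<not> E x b" if "b \<in> A" for b using F(6) x that by blast
    then have "q x \<notin> A" using q x by blast
    moreover have "insert (q x) A \<in> faces V E Z"
      by (rule insert_pendant[OF F(2), of "q x" x]) (use x q[OF x(2)] Nq[OF x(2)] F(3) no in blast)+
    moreover have "q x \<noteq> e" using q[OF x(2)] D by blast
    ultimately show ?thesis by blast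
  qed
qed

lemma exists_shedding:
  assumes "V \<notin> faces V E Z"
  shows "\<exists>v. shedding Z v"
proof (rule ccontr)
  assume none: "\<not> ?thesis"
  have a: "v \<notin> Z" if "simplicial s" "E s v" "v \<in> V" for s v
    using none shedding_if_simplicial_neighbour that by blast
  have b: "s = t" if "c \<in> V" "simplicial s" "E c s" "simplicial t" "E c t" for c s t
    using none shedding_if_two_simplicial_neighbours that by blast
  have simpV: "s \<in> V" if "simplicial s" for s using that by (simp add: simplicial_def)
  define W where "W = {x \<in> V. \<not> simplicial x}"
  have WV: "W \<subseteq> V" by (auto simp: W_def)
  interpret W: block_relation W E using WV by (rule restrict)
  have non: "\<exists>y\<in>V. \<exists>z\<in>V. E x y \<and> E x z \<and> y \<noteq> z \<and> \<not> E y z" if "x \<in> W" for x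
    using that by (auto simp: W_def simplicial_def)
  show False
  proof (cases "\<exists>x\<in>W. \<exists>y\<in>W. E x y")
    case False
    obtain u x y where u: "u \<in> V" "x \<in> V" "y \<in> V" "E u x" "u \<in> Z \<or> E u y \<and> y \<noteq> x"
      using assms unfolding faces_def by blast
    \<comment> \<open>When \<open>W\<close> has no edges, a non-simplicial vertex has only
      simplicial neighbours, and at least two of them.\<close>
    have "W = {}"
    proof (rule ccontr)
      assume "W \<noteq> {}"
      then obtain x where x: "x \<in> W" by blast
      then obtain y z where yz: "y \<in> V" "z \<in> V" "E x y" "E x z" "y \<noteq> z" using non by blast
      then have "simplicial y" "simplicial z" using False x by (auto simp: W_def)
      then show False using b[of x y z] x yz WV by blast
    qed
    then have "simplicial v" if "v \<in> V" for v using that by (auto simp: W_def)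
    then show False using u a[of x u] b[of u x y] sym by blast
  next
    case True
    obtain D e where D: "D \<subseteq> W" "e \<in> D" "D \<noteq> {e}"
        "\<And>x y. x \<in> D \<Longrightarrow> y \<in> D \<Longrightarrow> x \<noteq> y \<Longrightarrow> E x y"
        "\<And>x y. x \<in> D - {e} \<Longrightarrow> y \<in> W \<Longrightarrow> E x y \<Longrightarrow> y \<in> D"
      by (rule W.leaf_block[OF True]) (rule that)
    \<comment> \<open>Without a simplicial neighbour, all neighbours of \<open>x\<close> would lie
      in the clique \<open>D\<close>, making \<open>x\<close> simplicial.\<close>
    have "\<exists>q. simplicial q \<and> E x q" if x: "x \<in> D - {e}" for x
    proof (rule ccontr)
      assume "\<not> ?thesis"
      then have "y \<in> D" if "y \<in> V" "E x y" for y using D(5)[OF x, of y] that by (auto simp: W_def)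
      then show False using non[of x] x D(1,4) by blast
    qed
    then obtain q where q: "\<And>x. x \<in> D - {e} \<Longrightarrow> simplicial (q x) \<and> E x (q x)" by metis
    have qD: "q x \<in> V - D" if "x \<in> D - {e}" for x
      using q[OF that] D(1) by (auto simp: W_def simplicial_def)
    have N: "y \<in> D \<or> y = q x" if "x \<in> D - {e}" "y \<in> V" "E x y" for x y
      using D(1) D(5)[of x y] b[of x y "q x"] q[of x] that by (auto simp: W_def)
    have Nq: "y = x" if x: "x \<in> D - {e}" and y: "y \<in> V" "E (q x) y" for x y
    proof (rule ccontr)
      assume "y \<noteq> x"
      have xV: "x \<in> V" using x D(1) WV by blast
      have qx: "simplicial (q x)" "E x (q x)" "q x \<in> V" using q[OF x] simpV by auto
      then have "E x y" using y xV \<open>y \<noteq> x\<close> sym unfolding simplicial_def by metis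
      then have yD: "y \<in> D" using N[OF x y(1)] y irrefl by blast
      \<comment> \<open>If \<open>q x\<close> were adjacent to all of \<open>D - {x}\<close>, then
        \<open>x\<close> would be simplicial. A vertex \<open>z\<close> as claimed closes the
        4-cycle \<open>q x\<close>, \<open>x\<close>, \<open>z\<close>, \<open>y\<close>, and
        \<open>square\<close> supplies the missing edge from \<open>q x\<close> to
        \<open>z\<close>.\<close>
      have "\<exists>z\<in>D. z \<noteq> x \<and> \<not> E (q x) z"
      proof (rule ccontr)
        assume *: "\<not> ?thesis"
        obtain z w where "z \<in> V" "w \<in> V" "E x z" "E x w" "z \<noteq> w" "\<not> E z w"
          using non[of x] x D(1) by blast
        then show False using N[OF x, of z] N[OF x, of w] * D(4) sym irrefl by metis
      qed
      then obtain z where z: "z \<in> D" "z \<noteq> x" "\<not> E (q x) z" by blast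
      have "{q x, x, y, z} \<subseteq> V" "q x \<noteq> z" using qD[OF x] z yD xV D(1) WV by auto
      moreover have "E z x" "E z y" using z yD x D(4) y by (metis DiffD1)+
      ultimately show False using square[of "q x" x y z] qx y z sym \<open>y \<noteq> x\<close> by blast
    qed
    have "x \<notin> Z \<and> q x \<notin> Z" if x: "x \<in> D - {e}" for x
    proof -
      have "x \<in> V" using x D(1) WV by blast
      then show ?thesis using a[of "q x" x] q[OF x] qD[OF x] Nq[OF x] sym none
          shedding_if_pendant[of "q x" Z x] by blast
    qed
    then have "\<And>x. x \<in> D - {e} \<Longrightarrow> q x \<in> V - D \<and> E x (q x) \<and> x \<notin> Z \<and> q x \<notin> Z"
      using q qD by blast
    then have "shedding Z e"
      using D(1) WV by (intro shedding_if_pendant_block[OF _ D(2-4) _ N Nq]) blast+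
    then show False using none by blast
  qed
qed

end

text \<open>\<open>E\<close> and \<open>Z\<close> vary in the induction because links change them.
  It stops when \<open>V\<close> is itself a face, that is, when the complex is a simplex.\<close>

lemma order_shellable_faces:
  assumes "block_relation V E"
  shows "order_shellable (faces V E Z)"
  using assms
proof (induction "card V" arbitrary: V E Z rule: less_induct)
  case less
  interpret block_relation V E by fact
  show ?case
  proof (cases "V \<in> faces V E Z")
    case True
    then have "facets (faces V E Z) = {V}" by (auto simp: facets_def dest: faces_subset)
    then have "distinct [V] \<and> set [V] = facets (faces V E Z) \<and> shelling_order [V]"
      by (simp add: shelling_order_def)
    then show ?thesis unfolding order_shellable_def by blast
  next
    case False
    then obtain v where v: "shedding Z v" using exists_shedding by blast
    then have vV: "v \<in> V" by (simp add: shedding_def)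
    have card: "card W < card V" if "W \<subseteq> V - {v}" for W
    proof (rule psubset_card_mono[OF finite_V])
      show "W \<subset> V" using that vV by blast
    qed
    have "order_shellable (deletion v (faces V E Z))"
      unfolding deletion_faces using less.hyps[OF card restrict] by simp
    moreover have "order_shellable (link v (faces V E Z))"
    proof (cases "v \<in> Z")
      case True
      show ?thesis unfolding link_faces_in[OF vV True]
        by (rule less.hyps[OF card restrict]) auto
    next
      case False
      show ?thesis unfolding link_faces_notin[OF vV False]
        by (rule less.hyps[OF card block_relation.restrict[OF contract[OF vV]]]) auto
    qed
    moreover have "finite (faces V E Z)"
      using finite_V by (auto simp: faces_def intro: finite_subset[of _ "Pow V"])
    ultimately show ?thesis
      using order_shellable_shedding[of "faces V E Z" v] faces_down v
      unfolding shedding_def by metis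
  qed
qed


section \<open>Block graphs as digraphs\<close>

lemma reach_obtain_path:
  assumes "reach E S x y" "x \<in> S"
  shows "\<exists>p. p \<noteq> [] \<and> hd p = x \<and> last p = y \<and> distinct p \<and> set p \<subseteq> S \<and> successively E p"
  using assms(1) unfolding reach_def
proof (induction rule: rtranclp_induct)
  case base
  then show ?case using assms(2) by (intro exI[of _ "[x]"]) auto
next
  case (step y z)
  then obtain p where p: "p \<noteq> []" "hd p = x" "last p = y" "distinct p" "set p \<subseteq> S" "successively E p"
    by blast
  show ?case
  proof (cases "z \<in> set p")
    case True
    then obtain as bs where "p = as @ z # bs" by (meson split_list)
    then show ?thesis using p
      by (intro exI[of _ "as @ [z]"]) (auto simp: successively_append_iff hd_append)
  next
    case False
    then show ?thesis using p step
      by (intro exI[of _ "p @ [z]"]) (auto simp: successively_append_iff)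
  qed
qed

lemma path_reach_from_hd:
  assumes "successively E p" "set p \<subseteq> S" "v \<in> set p"
  shows "reach E S (hd p) v"
  using assms
proof (induction p)
  case (Cons a p)
  show ?case
  proof (cases "v = a")
    case False
    then have "v \<in> set p" "p \<noteq> []" using Cons.prems by auto
    then have "reach E S (hd p) v" "E a (hd p)" "hd p \<in> S"
      using Cons by (auto simp: successively_Cons)
    then show ?thesis using Cons.prems reach_trans[OF reach_adj] by auto
  qed simp
qed simp

lemma (in graph) dominates_sym: "u \<rightarrow> v \<Longrightarrow> v \<rightarrow> u"
  using sym_arcs by (rule arcs_ends_symmetric)

lemma (in graph) dominates_irrefl: "\<not> u \<rightarrow> u"
  using no_loops by (auto simp: arcs_ends_conv)

text \<open>\<open>connected\<close> refers to the symmetric closure of the arcs of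
  \<open>H\<close>, which stays within the adjacencies of the symmetric \<open>G\<close>.\<close>

lemma (in graph) connected_reach:
  assumes "subgraph H G" "connected H" "u \<in> verts H" "v \<in> verts H"
  shows "reach (dominates G) (verts H) u v"
proof -
  have "symcl (arcs_ends H) \<subseteq> arcs_ends G"
    using arcs_ends_mono[OF assms(1)] dominates_sym by (auto simp: symcl_def)
  moreover have "(u, v) \<in> rtrancl_on (verts H) (symcl (arcs_ends H))"
    using assms by (simp add: connected_conv)
  ultimately show ?thesis
    by (induction rule: rtrancl_on_induct[OF \<open>(u, v) \<in> _\<close>])
       (use reach_trans[OF _ reach_adj] in \<open>force+\<close>)
qed

lemma (in graph) connected_induce:
  assumes "c \<in> S" "\<And>v. v \<in> S \<Longrightarrow> reach (dominates G) S c v"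
  shows "connected (G \<restriction> S)"
  unfolding connected_conv
proof (intro conjI ballI)
  show "verts (G \<restriction> S) \<noteq> {}" using assms(1) by auto
  fix u v assume uv: "u \<in> verts (G \<restriction> S)" "v \<in> verts (G \<restriction> S)"
  have "reach (dominates G) S u c"
    using reach_sym[of "dominates G"] dominates_sym assms(2) uv by auto
  then have "reach (dominates G) S u v" using assms(2) uv reach_trans by force
  then show "(u, v) \<in> rtrancl_on (verts (G \<restriction> S)) (symcl (arcs_ends (G \<restriction> S)))"
    unfolding reach_def
  proof (induction rule: rtranclp_induct)
    case (step y z)
    then have "(y, z) \<in> symcl (arcs_ends (G \<restriction> S))" by (auto simp: symcl_def arcs_ends_conv)
    then show ?case using step by (auto intro: rtrancl_on_into_rtrancl_on)
  qed (use uv in simp)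
qed

text \<open>A candidate with the largest number of vertices plus arcs is maximal: a candidate above
  it has the same vertices and arcs, and compatibility makes the records equal.\<close>

lemma max_subgraph_above:
  assumes fin: "finite (verts G)" "finite (arcs G)" and H: "subgraph H G" "P H"
  shows "\<exists>B. pre_digraph.max_subgraph G P B \<and> subgraph H B"
proof -
  define S where "S = {K. subgraph K G \<and> P K \<and> subgraph H K}"
  define m where "m K = card (verts K) + card (arcs K)" for K :: "('a, 'b) pre_digraph"
  have "H \<in> S" using H by (auto simp: S_def subgraph_def compatible_def)
  moreover have "\<forall>K. K \<in> S \<longrightarrow> m K < Suc (card (verts G) + card (arcs G))"
    using fin by (auto simp: S_def m_def subgraph_def less_Suc_eq_le intro!: add_mono card_mono)
  ultimately obtain B where B: "B \<in> S" "\<And>K. K \<in> S \<Longrightarrow> m K \<le> m B"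
    using ex_has_greatest_nat[of "\<lambda>K. K \<in> S" H m] by blast
  have "K = B" if K: "subgraph B K" "subgraph K G" "P K" for K
  proof -
    have "K \<in> S" using K B(1) by (auto simp: S_def subgraph_def compatible_def)
    then have le: "m K \<le> m B" by (rule B(2))
    have sub: "verts B \<subseteq> verts K" "arcs B \<subseteq> arcs K" using K(1) by (auto simp: subgraph_def)
    have f: "finite (verts K)" "finite (arcs K)"
      using K(2) fin by (auto simp: subgraph_def intro: finite_subset)
    have "card (verts B) \<le> card (verts K)" "card (arcs B) \<le> card (arcs K)"
      using sub f by (auto intro: card_mono)
    then have "card (verts K) \<le> card (verts B)" "card (arcs K) \<le> card (arcs B)"
      using le by (auto simp: m_def)
    then have "verts B = verts K" "arcs B = arcs K" using sub f by (metis card_seteq)+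
    then show "K = B" using K(1)
      by (intro pre_digraph.equality) (auto simp: subgraph_def compatible_def)
  qed
  then show ?thesis using B(1) by (auto simp: pre_digraph.max_subgraph_def S_def)
qed

text \<open>A path from \<open>x\<close> to \<open>y\<close> avoiding \<open>r\<close> closes to a
  cycle through \<open>r\<close>. The subgraph induced on the cycle stays connected after deleting
  any vertex, so it lies in a block, which is complete.\<close>

lemma block_relation_if_block_graph:
  assumes "graph G" "block_graph G"
  shows "block_relation (verts G) (dominates G)"
proof -
  interpret graph G by fact
  have "x \<rightarrow>\<^bsub>G\<^esub> y" if r: "r \<in> verts G" and xy: "x \<in> verts G" "y \<in> verts G" "r \<rightarrow>\<^bsub>G\<^esub> x" "r \<rightarrow>\<^bsub>G\<^esub> y" "x \<noteq> y"
    and reach: "reach (dominates G) (verts G - {r}) x y" for r x y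
  proof -
    have "x \<in> verts G - {r}" using xy dominates_irrefl by auto
    then obtain p where p: "p \<noteq> []" "hd p = x" "last p = y" "distinct p" "set p \<subseteq> verts G - {r}"
        "successively (dominates G) p"
      using reach_obtain_path[OF reach] by blast
    define S where "S = insert r (set p)"
    define H where "H = G \<restriction> S"
    have SV: "S \<subseteq> verts G" using r p by (auto simp: S_def)
    have "induced_subgraph H G" unfolding H_def using SV by (rule induced_induce)
    then have "digraph H" "symmetric H"
      using digraphI_induced induced_graph_imp_symmetric sym_arcs by auto
    then have "graph H" by (rule digraph.graphI)
    moreover have "connected H"
      unfolding H_def
    proof (rule connected_induce)
      show "r \<in> S" by (simp add: S_def)
      fix v assume "v \<in> S"
      have "reach (dominates G) S r x" using xy p by (intro reach_adj) (auto simp: S_def)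
      moreover have "reach (dominates G) S x v" if "v \<in> set p"
        using path_reach_from_hd[OF p(6) _ that] p(2) by (auto simp: S_def)
      ultimately show "reach (dominates G) S r v"
        using \<open>v \<in> S\<close> reach_trans by (fastforce simp: S_def)
    qed
    moreover have "connected (pre_digraph.del_vert H v)" if "v \<in> S" for v
    proof -
      have del: "pre_digraph.del_vert H v = G \<restriction> (S - {v})"
        by (rule pre_digraph.equality) (auto simp: H_def pre_digraph.del_vert_def)
      show ?thesis
      proof (cases "v = r")
        case True
        then have Sv: "S - {v} = set p" using p(5) by (auto simp: S_def)
        show ?thesis unfolding del Sv
          by (rule connected_induce[OF hd_in_set[OF p(1)] path_reach_from_hd[OF p(6) subset_refl]])
      next
        case False
        then have "v \<in> set p" using that by (simp add: S_def)
        \<comment> \<open>Deleting \<open>v\<close> splits the path; \<open>as\<close> remains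
          attached to \<open>r\<close> through \<open>x\<close>, and \<open>bs\<close> through
          \<open>y\<close>.\<close>
        then obtain as bs where asbs: "p = as @ v # bs" by (meson split_list)
        define T where "T = S - {v}"
        have T: "T = insert r (set as \<union> set bs)" using asbs p(4) False by (auto simp: S_def T_def)
        have sub: "set as \<subseteq> T" "set bs \<subseteq> T" using T by auto
        have succ: "successively (dominates G) as" "successively (dominates G) bs"
          using p(6) asbs by (auto simp: successively_append_iff successively_Cons)
        have "reach (dominates G) T r w" if w: "w \<in> T" for w
        proof -
          consider "w = r" | "w \<in> set as" | "w \<in> set bs" using w T by blast
          then show ?thesis
          proof cases
            case 2
            then have "as \<noteq> []" by auto
            then have hd: "hd as = x" using asbs p(2) by auto
            then have "x \<in> T" using \<open>as \<noteq> []\<close> T by (metis UnI1 hd_in_set insertCI)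
            then have "reach (dominates G) T r x" using xy T by (intro reach_adj) auto
            moreover have "reach (dominates G) T x w"
              using path_reach_from_hd[OF succ(1) sub(1) 2] hd by simp
            ultimately show ?thesis by (rule reach_trans)
          next
            case 3
            then have "bs \<noteq> []" by auto
            then have last: "last bs = y" using asbs p(3) by auto
            then have "y \<in> set bs" using \<open>bs \<noteq> []\<close> by (metis last_in_set)
            then have ry: "reach (dominates G) T r y" using xy T by (intro reach_adj) auto
            have from_hd: "reach (dominates G) T (hd bs) u" if "u \<in> set bs" for u
              using path_reach_from_hd[OF succ(2) sub(2) that] .
            then have "reach (dominates G) T y (hd bs)"
              using \<open>y \<in> set bs\<close> reach_sym[of "dominates G"] dominates_sym by blast
            then have "reach (dominates G) T y w" using from_hd[OF 3] by (rule reach_trans)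
            with ry show ?thesis by (rule reach_trans)
          qed simp
        qed
        moreover have "r \<in> T" by (simp add: T)
        ultimately have "connected (G \<restriction> T)" using connected_induce[of r T] by simp
        then show ?thesis by (simp add: del T_def)
      qed
    qed
    moreover have "subgraph H G" using \<open>induced_subgraph H G\<close> by (rule induced_imp_subgraph)
    ultimately obtain B where B: "is_block G B" "subgraph H B"
      using max_subgraph_above[OF finite_verts finite_arcs, of H "\<lambda>H. graph H \<and> connected H \<and>
        (\<forall>v\<in>verts H. verts H \<noteq> {v} \<longrightarrow> connected (pre_digraph.del_vert H v))"]
      unfolding is_block_def by (auto simp: H_def)
    have "x \<in> S" "y \<in> S" using p(1-3) by (auto simp: S_def)
    then have "x \<in> verts B" "y \<in> verts B" using B(2) by (auto simp: H_def subgraph_def)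
    then have "(x, y) \<in> arcs_ends B"
      using assms(2) B(1) \<open>x \<noteq> y\<close> by (auto simp: block_graph_def complete_digraph_def)
    moreover have "subgraph B G" using B(1) by (simp add: is_block_def pre_digraph.max_subgraph_def)
    ultimately show "x \<rightarrow>\<^bsub>G\<^esub> y" using arcs_ends_mono by blast
  qed
  then show ?thesis
    using finite_verts dominates_sym dominates_irrefl by unfold_locales
qed

section \<open>The 2-independence complex as a generalised complex\<close>

lemma Ind_2_eq_faces:
  assumes "graph G"
  shows "Ind 2 G = faces (verts G) (dominates G) {}"
proof (intro equalityI subsetI)
  interpret graph G by fact
  fix A assume "A \<in> Ind 2 G"
  then have A: "A \<subseteq> verts G" "\<And>C. is_component (G \<restriction> A) C \<Longrightarrow> card (verts C) \<le> 2"
    by (auto simp: Ind_def r_independent_def)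
  have "b = a" if uab: "u \<in> A" "a \<in> A" "b \<in> A" "u \<rightarrow>\<^bsub>G\<^esub> a" "u \<rightarrow>\<^bsub>G\<^esub> b" for u a b
  proof (rule ccontr)
    assume "b \<noteq> a"
    \<comment> \<open>Two neighbours of \<open>u\<close> in \<open>A\<close> give a connected set of
      three vertices, hence a component that is too large.\<close>
    define T where "T = {u, a, b}"
    have "reach (dominates G) T u v" if "v \<in> T" for v
      using that uab reach_adj[of "dominates G" u v T] by (auto simp: T_def)
    then have con: "connected (G \<restriction> T)" by (intro connected_induce[of u]) (auto simp: T_def)
    have "subgraph (G \<restriction> T) (G \<restriction> A)"
      using uab by (auto simp: T_def subgraph_def compatible_def wf_digraph_def)
    moreover have "finite (verts (G \<restriction> A))" "finite (arcs (G \<restriction> A))"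
      using A(1) by (auto intro: finite_subset)
    ultimately obtain C where C: "is_component (G \<restriction> A) C" "subgraph (G \<restriction> T) C"
      using con connected_subgraph_in_component by metis
    then have "T \<subseteq> verts C" "verts C \<subseteq> A"
      by (auto simp: is_component_def pre_digraph.max_subgraph_def subgraph_def)
    then have "card T \<le> card (verts C)"
      using A(1) finite_verts by (meson card_mono finite_subset)
    moreover have "card T = 3" using uab \<open>b \<noteq> a\<close> dominates_irrefl by (auto simp: T_def card_insert_if)
    ultimately show False using A(2)[OF C(1)] by simp
  qed
  then show "A \<in> faces (verts G) (dominates G) {}" using A(1) by (simp add: faces_def)
next
  interpret graph G by fact
  fix A assume A: "A \<in> faces (verts G) (dominates G) {}"
  have "card (verts C) \<le> 2" if "is_component (G \<restriction> A) C" for C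
  proof -
    have C: "subgraph C (G \<restriction> A)" "connected C"
      using that by (auto simp: is_component_def pre_digraph.max_subgraph_def)
    have CA: "verts C \<subseteq> A" using C(1) by (simp add: subgraph_def)
    have uniq: "b = a" if "u \<in> verts C" "a \<in> verts C" "b \<in> verts C" "u \<rightarrow>\<^bsub>G\<^esub> a" "u \<rightarrow>\<^bsub>G\<^esub> b" for u a b
      using A CA that unfolding faces_def by blast
    have "subgraph (G \<restriction> A) G" using A faces_subset subgraph_induce_subgraphI by blast
    then have CG: "subgraph C G" using C(1) subgraph_trans by blast
    obtain u where u: "u \<in> verts C" using C(2) by (auto simp: connected_conv)
    \<comment> \<open>A neighbour of \<open>u\<close> has \<open>u\<close> as its only neighbour in
      \<open>C\<close>, so a walk from \<open>u\<close> never gets further.\<close>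
    have near: "v = u \<or> u \<rightarrow>\<^bsub>G\<^esub> v" if "v \<in> verts C" for v
      using connected_reach[OF CG C(2) u that] unfolding reach_def
    proof (induction rule: rtranclp_induct)
      case (step y z)
      then show ?case using uniq[of y u z] u dominates_sym by blast
    qed simp
    have "\<exists>a. verts C \<subseteq> {u, a}"
    proof (cases "\<exists>a\<in>verts C. u \<rightarrow>\<^bsub>G\<^esub> a")
      case True
      then show ?thesis using near uniq u by blast
    qed (use near in blast)
    then obtain a where "verts C \<subseteq> {u, a}" ..
    then have "card (verts C) \<le> card {u, a}" by (intro card_mono) auto
    also have "\<dots> \<le> 2" by (simp add: card_insert_if)
    finally show ?thesis .
  qed
  then show "A \<in> Ind 2 G" using faces_subset[OF A] by (auto simp: Ind_def r_independent_def)
qed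

theorem theorem4p7:
  fixes G :: "('a, 'b) pre_digraph"
  assumes "graph G"
    and "block_graph G"
  shows "shellable (Ind 2 G)"
proof -
  interpret block_relation "verts G" "dominates G"
    using assms by (rule block_relation_if_block_graph)
  obtain Fs where "distinct Fs" "set Fs = facets (Ind 2 G)" "shelling_order Fs"
    using order_shellable_faces[OF block_relation_axioms] Ind_2_eq_faces[OF assms(1)]
    unfolding order_shellable_def by metis
  moreover have "finite F" if "F \<in> Ind 2 G" for F
    using that finite_V faces_subset finite_subset Ind_2_eq_faces[OF assms(1)] by metis
  ultimately show ?thesis
    using shelling_if_shelling_order unfolding shellable_def by metis
qed

end
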